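(* Let $B$ and $C$ be linear endomorphisms of $V$ with $B=B^*$ and $C=-C^*$, and let $\dim V\ge 3$. If $\{R^S_I, R^S_B, R^{\Lambda}_C\}$ is properly linearly dependent, then $BC=CB$ and $\operatorname{Rank}(C)=2$.
   Context: $V$ is a finite-dimensional real vector space, $\phi$ a positive definite inner product on $V$, $A^*$ the adjoint of $A$ with respect to $\phi$, and $I$ the identity endomorphism. For an endomorphism $A$ of $V$, $$R^S_{A}(x,y,z,w)= \phi (Ax,w) \phi (Ay,z) - \phi (Ax,z) \phi (Ay,w),$$ $$R^{\Lambda}_{A} (x,y,z,w) =\phi (Ax,w) \phi (Ay,z) - \phi (Ax,z) \phi (Ay,w) -2 \phi (Ax,y) \phi (Az,w).$$ A set (indexed family) of such tensors, viewed in the real vector space of multilinear maps $V^4\to\mathbb{R}$, is called properly linearly dependent if it is linearly dependent but none of its proper subsets (subfamilies) is linearly dependent. *)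

theory Defs
  imports "HOL-Analysis.Analysis"
begin

text \<open>
  The finite-dimensional inner product space $(V,\phi)$ is a type of class
  \<^class>\<open>euclidean_space\<close>, with $\phi$ the inner product of the class.
\<close>

definition R_S :: "('v::euclidean_space \<Rightarrow> 'v) \<Rightarrow> 'v \<Rightarrow> 'v \<Rightarrow> 'v \<Rightarrow> 'v \<Rightarrow> real" where
  "R_S A x y z w = (A x \<bullet> w) * (A y \<bullet> z) - (A x \<bullet> z) * (A y \<bullet> w)"

definition R_Lambda :: "('v::euclidean_space \<Rightarrow> 'v) \<Rightarrow> 'v \<Rightarrow> 'v \<Rightarrow> 'v \<Rightarrow> 'v \<Rightarrow> real" where
  "R_Lambda A x y z w =
     (A x \<bullet> w) * (A y \<bullet> z) - (A x \<bullet> z) * (A y \<bullet> w) - 2 * (A x \<bullet> y) * (A z \<bullet> w)"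

text \<open>
  Linear dependence of the subfamily $(T_i)_{i \in J}$ of a family of 4-tensors, for the
  pointwise vector space operations. Being about families rather than sets, it counts a
  repeated tensor as dependent.
\<close>

definition lin_dependent_family ::
    "('i \<Rightarrow> 'v \<Rightarrow> 'v \<Rightarrow> 'v \<Rightarrow> 'v \<Rightarrow> real) \<Rightarrow> 'i set \<Rightarrow> bool" where
  "lin_dependent_family T J \<longleftrightarrow>
     (\<exists>F c. finite F \<and> F \<subseteq> J \<and> (\<exists>i\<in>F. c i \<noteq> 0) \<and>
        (\<forall>x y z w. (\<Sum>i\<in>F. c i * T i x y z w) = (0::real)))"

definition properly_lin_dependent_family ::
    "('i \<Rightarrow> 'v \<Rightarrow> 'v \<Rightarrow> 'v \<Rightarrow> 'v \<Rightarrow> real) \<Rightarrow> 'i set \<Rightarrow> bool" where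
  "properly_lin_dependent_family T J \<longleftrightarrow>
     lin_dependent_family T J \<and> (\<forall>K. K \<subset> J \<longrightarrow> \<not> lin_dependent_family T K)"

end

theory Submission
  imports Defs
begin

text \<open>
  Write the dependence relation as \<open>a R\<^sup>S\<^sub>I + b R\<^sup>S\<^sub>B + c R\<^sup>\<Lambda>\<^sub>C = 0\<close>. Properness makes all three
  coefficients nonzero and also gives \<open>C \<noteq> 0\<close>.

  The key is the component \<open>(y, x, x, z)\<close> of the relation at an eigenvector \<open>x\<close> of \<open>B\<close>, with
  eigenvalue \<open>\<lambda>\<close>. On the orthogonal complement of \<open>x\<close> this determines \<open>B\<close>: the operator
  \<open>\<bar>x\<bar>\<^sup>2 (a I + b \<lambda> B)\<close> is a multiple of the rank one form \<open>Cx \<otimes> Cx\<close>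
  (\<open>eigenvector_relation\<close>). Since the complement has dimension at least \<open>2\<close>, it contains a nonzero
  vector orthogonal to \<open>Cx\<close>, which forces \<open>\<lambda> \<noteq> 0\<close>. Thus a single eigenvector already
  diagonalises \<open>B\<close>.

  If \<open>Cx = 0\<close>, then \<open>B\<close> is scalar on the complement of \<open>x\<close>, so every vector there is an
  eigenvector; as \<open>C \<noteq> 0\<close>, one of them is not killed by \<open>C\<close>. Hence there is an eigenvector \<open>x\<close>
  with \<open>y = Cx \<noteq> 0\<close>. On the complement of the plane spanned by \<open>x\<close> and \<open>y\<close>, \<open>B\<close> is
  \<open>\<mu> = - a / (b \<lambda>)\<close>. The components \<open>(x, y, y, z)\<close> and \<open>(x, y, z, w)\<close> of the relation, with
  \<open>z\<close> and \<open>w\<close> in that complement, then show that \<open>C\<close> vanishes on it, so \<open>C\<close> is a rotation by a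
  right angle and a scaling in the plane, of rank \<open>2\<close>. Finally, the complement contains a
  nonzero \<open>z\<close> because the dimension is at least \<open>3\<close>; the key evaluation at this eigenvector,
  which \<open>C\<close> kills, gives \<open>By = - a / (b \<mu>) y = \<lambda> y\<close>. So \<open>B\<close> is scalar on the plane and on its
  complement, both of which \<open>C\<close> preserves: they commute.
\<close>

section \<open>Proper linear dependence\<close>

text \<open>
  A vanishing coefficient could be dropped from the relation, which would leave a dependent
  proper subfamily.
\<close>

lemma properly_lin_dependent_family_coeffs:
  assumes "properly_lin_dependent_family T J"
  obtains c where "finite J" "\<forall>i\<in>J. c i \<noteq> 0"
    "\<forall>x y z w. (\<Sum>i\<in>J. c i * T i x y z w) = 0"
proof -
  obtain F c where F: "finite F" "F \<subseteq> J" "\<exists>i\<in>F. c i \<noteq> 0"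
    and sum: "\<And>x y z w. (\<Sum>i\<in>F. c i * T i x y z w) = 0"
    using assms unfolding properly_lin_dependent_family_def lin_dependent_family_def by blast
  define G where "G = {i \<in> F. c i \<noteq> 0}"
  have "(\<Sum>i\<in>G. c i * T i x y z w) = (\<Sum>i\<in>F. c i * T i x y z w)" for x y z w
    unfolding G_def using F(1) by (intro sum.mono_neutral_left) auto
  then have sumG: "(\<Sum>i\<in>G. c i * T i x y z w) = 0" for x y z w
    using sum by simp
  have G: "finite G" "G \<subseteq> J" "\<exists>i\<in>G. c i \<noteq> 0" "\<And>i. i \<in> G \<Longrightarrow> c i \<noteq> 0"
    using F by (auto simp: G_def)
  have "lin_dependent_family T G"
    unfolding lin_dependent_family_def using G sumG by blast
  then have "G = J"
    using assms G(2) unfolding properly_lin_dependent_family_def by blast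
  then show thesis
    using that[of c] G sumG by blast
qed

lemma properly_lin_dependent_family_nonzero:
  assumes "properly_lin_dependent_family T J" "i \<in> J" "J \<noteq> {i}"
  obtains x y z w where "T i x y z w \<noteq> 0"
proof (rule ccontr)
  assume "\<not> thesis"
  then have "\<forall>x y z w. (\<Sum>j\<in>{i}. 1 * T j x y z w) = 0"
    using that by auto
  then have "lin_dependent_family T {i}"
    unfolding lin_dependent_family_def
    by (intro exI[of _ "{i}"] exI[of _ "\<lambda>_. 1"]) auto
  then show False
    using assms unfolding properly_lin_dependent_family_def by blast
qed

section \<open>Orthogonality in Euclidean spaces\<close>

lemma exists_orthogonal_to_two:
  fixes u v :: "'v::euclidean_space"
  assumes "DIM('v) \<ge> 3"
  obtains z where "z \<noteq> 0" "z \<bullet> u = 0" "z \<bullet> v = 0"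
proof -
  have "dim {u, v} \<le> card {u, v}"
    by (rule dim_le_card') simp
  also have "\<dots> \<le> 2"
    by (simp add: card_insert_if)
  finally have "dim {u, v} < DIM('v)"
    using assms by simp
  then obtain z where "z \<noteq> 0" "\<And>y. y \<in> span {u, v} \<Longrightarrow> orthogonal z y"
    using orthogonal_to_subspace_exists by blast
  then show thesis
    using that by (simp add: orthogonal_def span_base)
qed

lemma orthogonal_decomposition:
  fixes x v :: "'v::real_inner"
  assumes "x \<noteq> 0"
  obtains r z where "v = r *\<^sub>R x + z" "z \<bullet> x = 0"
  using assms by (intro that[of "(v \<bullet> x) / (x \<bullet> x)" "v - ((v \<bullet> x) / (x \<bullet> x)) *\<^sub>R x"])
    (auto simp: inner_diff_left)

lemma orthogonal_decomposition_two:
  fixes x y v :: "'v::real_inner"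
  assumes "x \<noteq> 0" "y \<noteq> 0" "y \<bullet> x = 0"
  obtains r s z where "v = r *\<^sub>R x + s *\<^sub>R y + z" "z \<bullet> x = 0" "z \<bullet> y = 0"
proof -
  obtain r v' where v: "v = r *\<^sub>R x + v'" "v' \<bullet> x = 0"
    using orthogonal_decomposition[OF assms(1)] .
  obtain s z where z: "v' = s *\<^sub>R y + z" "z \<bullet> y = 0"
    using orthogonal_decomposition[OF assms(2)] .
  show thesis
    using v z assms(3) by (intro that[of r s z]) (auto simp: inner_add_left)
qed

text \<open>
  At a maximiser \<open>x\<close> of \<open>v \<bullet> Bv\<close> on the unit sphere, with maximum \<open>m\<close>, the form
  \<open>Q(u,v) = m (u \<bullet> v) - Bu \<bullet> v\<close> is positive semidefinite with \<open>Q(x,x) = 0\<close>, so \<open>Q(x,v) = 0\<close> for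
  all \<open>v\<close>.
\<close>

lemma self_adjoint_has_eigenvector:
  fixes B :: "'v::euclidean_space \<Rightarrow> 'v"
  assumes lin: "linear B" and sym: "\<And>u v. B u \<bullet> v = u \<bullet> B v"
  obtains x l where "x \<noteq> 0" "B x = l *\<^sub>R x"
proof -
  interpret linear B by (rule lin)
  have "continuous_on (sphere 0 1) (\<lambda>v. v \<bullet> B v)"
    by (intro continuous_intros linear_continuous_on linear_conv_bounded_linear[THEN iffD1] lin)
  moreover have "sphere (0::'v) 1 \<noteq> {}"
    by simp
  ultimately obtain x where x: "x \<in> sphere 0 1"
    and max: "\<And>v. v \<in> sphere 0 1 \<Longrightarrow> v \<bullet> B v \<le> x \<bullet> B x"
    using continuous_attains_sup[OF compact_sphere, of 0 1 "\<lambda>v. v \<bullet> B v"] by blast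
  define m where "m = x \<bullet> B x"
  have x1: "x \<bullet> x = 1" "norm x = 1"
    using x by (auto simp: dot_square_norm)
  have psd: "v \<bullet> B v \<le> m * (v \<bullet> v)" for v
  proof (cases "v = 0")
    case False
    have "(v /\<^sub>R norm v) \<bullet> B (v /\<^sub>R norm v) \<le> m"
      unfolding m_def using False by (intro max) simp
    then have "v \<bullet> B v / (norm v)\<^sup>2 \<le> m"
      by (simp add: scale power2_eq_square divide_inverse mult_ac)
    then show ?thesis
      using False by (simp add: divide_le_eq dot_square_norm)
  qed (simp add: zero)
  define d where "d = m *\<^sub>R x - B x"
  \<comment> \<open>Moving from \<open>x\<close> in the direction \<open>-td\<close> changes \<open>Q\<close> by \<open>-2t (d \<bullet> d)\<close> to first order.\<close>
  have quad: "0 \<le> t\<^sup>2 * (m * (d \<bullet> d) - d \<bullet> B d) - 2 * t * (d \<bullet> d)" for t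
  proof -
    have dd: "m * (x \<bullet> d) - B x \<bullet> d = d \<bullet> d"
      by (metis d_def inner_diff_left inner_scaleR_left)
    have "x \<bullet> B d = B x \<bullet> d" "d \<bullet> B x = B x \<bullet> d"
      by (simp_all add: sym inner_commute[of d "B x"])
    then have "0 \<le> t\<^sup>2 * (m * (d \<bullet> d) - d \<bullet> B d) - 2 * t * (m * (x \<bullet> d) - B x \<bullet> d)"
      using psd[of "x - t *\<^sub>R d"] x1
      by (simp add: diff scale inner_diff_left inner_diff_right m_def[symmetric]
          inner_commute[of d x] algebra_simps power2_eq_square)
    then show ?thesis
      by (simp only: dd)
  qed
  have "d \<bullet> d \<le> 0"
  proof (rule ccontr)
    assume "\<not> d \<bullet> d \<le> 0"
    then have pos: "0 < d \<bullet> d"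
      by (simp only: not_le)
    define K where "K = m * (d \<bullet> d) - d \<bullet> B d"
    have K: "0 \<le> K"
      using psd[of d] by (simp add: K_def)
    \<comment> \<open>A step so small that the quadratic term does not outweigh the linear one.\<close>
    define t where "t = (d \<bullet> d) / (K + 1)"
    have t: "t > 0" "t * (K + 1) = d \<bullet> d"
      using pos K by (auto simp: t_def simp del: inner_gt_zero_iff)
    have "0 \<le> t * (t * K - 2 * (d \<bullet> d))"
      using quad[of t] by (simp add: K_def algebra_simps power2_eq_square)
    then have "2 * (d \<bullet> d) \<le> t * K"
      using t(1) by (simp add: zero_le_mult_iff)
    then show False
      using t pos by (simp add: algebra_simps)
  qed
  then have "d = 0"
    by (metis inner_gt_zero_iff not_le)
  then have "B x = m *\<^sub>R x"
    by (simp add: d_def)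
  moreover have "x \<noteq> 0"
    using x1 by auto
  ultimately show thesis
    using that by blast
qed

section \<open>Consequences of the curvature relation\<close>

locale curvature_relation =
  fixes B C :: "'v::euclidean_space \<Rightarrow> 'v" and a b c :: real
  assumes linB: "linear B" and linC: "linear C"
    and sym: "\<And>u v. B u \<bullet> v = u \<bullet> B v"
    and skew: "\<And>u v. C u \<bullet> v = - (u \<bullet> C v)"
    and dim3: "DIM('v) \<ge> 3"
    and nz: "a \<noteq> 0" "b \<noteq> 0" "c \<noteq> 0" and C_nonzero: "\<exists>v. C v \<noteq> 0"
    and rel: "\<And>x y z w. a * R_S id x y z w + b * R_S B x y z w + c * R_Lambda C x y z w = 0"
begin

sublocale B: linear B by (rule linB)
sublocale C: linear C by (rule linC)

lemma C_self: "C u \<bullet> u = 0"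
  using skew[of u u] by (simp add: inner_commute)

text \<open>
  For \<open>z\<close> orthogonal to \<open>x\<close>, the component \<open>(y, x, x, z)\<close> of the relation is the inner product of \<open>z\<close>
  with the vector on the left below. That vector is itself orthogonal to \<open>x\<close>, so it may be tested
  against itself.
\<close>

lemma eigenvector_relation:
  assumes Bx: "B x = l *\<^sub>R x" and y: "y \<bullet> x = 0"
  shows "(x \<bullet> x) *\<^sub>R (a *\<^sub>R y + (b * l) *\<^sub>R B y) + (3 * c * (C x \<bullet> y)) *\<^sub>R C x = 0"
    (is "?u = 0")
proof -
  have By: "B y \<bullet> x = 0"
    by (simp add: sym Bx y)
  have ux: "?u \<bullet> x = 0"
    by (simp add: inner_add_left y By C_self)
  have Cyx: "C y \<bullet> x = - (C x \<bullet> y)"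
    by (subst inner_commute[of "C x"]) (rule skew)
  have xu: "x \<bullet> ?u = 0"
    using ux by (simp only: inner_commute)
  have "?u \<bullet> z = 0" if "x \<bullet> z = 0" for z
    using rel[of y x x z] that y By Cyx
    by (simp add: R_S_def R_Lambda_def Bx C_self inner_add_left algebra_simps)
  then have "?u \<bullet> ?u = 0"
    using xu by blast
  then show ?thesis
    by simp
qed

lemma eigenvalue_nonzero:
  assumes "B x = l *\<^sub>R x" "x \<noteq> 0"
  shows "l \<noteq> 0"
proof
  assume l: "l = 0"
  obtain y where "y \<noteq> 0" "y \<bullet> x = 0" "y \<bullet> C x = 0"
    using exists_orthogonal_to_two[OF dim3] .
  then show False
    using eigenvector_relation[OF assms(1), of y] assms(2) nz l by (simp add: inner_commute)
qed

lemma B_on_complement: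
  assumes Bx: "B x = l *\<^sub>R x" and "x \<noteq> 0" and "z \<bullet> x = 0" "C x \<bullet> z = 0"
  shows "B z = (- a / (b * l)) *\<^sub>R z"
proof -
  have l: "l \<noteq> 0"
    using eigenvalue_nonzero[OF assms(1,2)] .
  have "a *\<^sub>R z + (b * l) *\<^sub>R B z = 0"
    using eigenvector_relation[OF Bx assms(3)] assms(2,4) by simp
  then have "(b * l) *\<^sub>R B z = (- a) *\<^sub>R z"
    by (simp add: add_eq_0_iff2)
  then have "(1 / (b * l)) *\<^sub>R ((b * l) *\<^sub>R B z) = (1 / (b * l)) *\<^sub>R ((- a) *\<^sub>R z)"
    by simp
  then show ?thesis
    using l nz by simp
qed

lemma eigenvector_outside_kernel:
  obtains x l where "B x = l *\<^sub>R x" "C x \<noteq> 0"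
proof -
  obtain x l where x: "x \<noteq> 0" "B x = l *\<^sub>R x"
    using self_adjoint_has_eigenvector[OF linB sym] .
  show thesis
  proof (cases "C x = 0")
    case True
    obtain v where v: "C v \<noteq> 0"
      using C_nonzero by blast
    obtain r z where z: "v = r *\<^sub>R x + z" "z \<bullet> x = 0"
      using orthogonal_decomposition[OF x(1)] .
    have "C z \<noteq> 0"
      using v True by (simp add: z(1) C.add C.scale)
    moreover have "B z = (- a / (b * l)) *\<^sub>R z"
      using B_on_complement[OF x(2,1) z(2)] True by simp
    ultimately show thesis
      by (intro that)
  qed (rule that[OF x(2)])
qed

text \<open>
  The plane is spanned by \<open>x\<close> and \<open>y = Cx\<close>. On it \<open>C\<close> acts by \<open>x \<mapsto> y\<close> and \<open>y \<mapsto> k x\<close>.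
\<close>

lemma plane_structure:
  obtains x y l m k where "x \<noteq> 0" "y \<noteq> 0" "y \<bullet> x = 0" "C x = y" "C y = k *\<^sub>R x" "k \<noteq> 0"
    "B x = l *\<^sub>R x" "B y = l *\<^sub>R y"
    "\<And>z. z \<bullet> x = 0 \<Longrightarrow> z \<bullet> y = 0 \<Longrightarrow> C z = 0 \<and> B z = m *\<^sub>R z"
proof -
  obtain x l where Bx: "B x = l *\<^sub>R x" and Cx: "C x \<noteq> 0"
    using eigenvector_outside_kernel .
  define y where "y = C x"
  define m where "m = - a / (b * l)"
  have x0: "x \<noteq> 0"
    using Cx C.zero by auto
  have y0: "y \<noteq> 0" and yx: "y \<bullet> x = 0" "x \<bullet> y = 0"
    using Cx C_self[of x] by (auto simp: y_def inner_commute)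
  have yy: "y \<bullet> y \<noteq> 0"
    using y0 by simp
  have l0: "l \<noteq> 0"
    using eigenvalue_nonzero[OF Bx x0] .
  have Bz: "B z = m *\<^sub>R z" if "z \<bullet> x = 0" "z \<bullet> y = 0" for z
    unfolding m_def using B_on_complement[OF Bx x0] that by (simp add: y_def inner_commute)
  have Byz: "B y \<bullet> z = 0" if "z \<bullet> x = 0" "z \<bullet> y = 0" for z
    using Bz[OF that] that by (simp add: sym inner_commute[of y])
  have Cyz: "C y \<bullet> z = 0" if z: "z \<bullet> x = 0" "z \<bullet> y = 0" for z
    using rel[of x y y z] nz yy yx Byz[OF z] z
    by (simp add: R_S_def R_Lambda_def Bx C_self y_def[symmetric] inner_commute)
  have Czw: "C z \<bullet> w = 0"
    if z: "z \<bullet> x = 0" "z \<bullet> y = 0" and w: "w \<bullet> x = 0" "w \<bullet> y = 0" for z w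
    using rel[of x y z w] nz yy yx Byz[OF z] Byz[OF w] Cyz[OF z] Cyz[OF w] z w
    by (simp add: R_S_def R_Lambda_def Bx C_self y_def[symmetric] inner_commute)
  have Cz: "C z = 0" if z: "z \<bullet> x = 0" "z \<bullet> y = 0" for z
  proof -
    have "C z \<bullet> x = 0" "C z \<bullet> y = 0"
      using z Cyz[OF z] skew[of z x] skew[of z y]
      by (simp_all add: y_def[symmetric] inner_commute[of z "C y"])
    then have "C z \<bullet> C z = 0"
      using Czw[OF z] by blast
    then show ?thesis
      by simp
  qed
  obtain r s z where Cy: "C y = r *\<^sub>R x + s *\<^sub>R y + z" and z: "z \<bullet> x = 0" "z \<bullet> y = 0"
    using orthogonal_decomposition_two[OF x0 y0 yx(1)] .
  have "s * (y \<bullet> y) = 0"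
    using C_self[of y] z yx by (simp add: Cy inner_add_left)
  moreover have "z \<bullet> z = 0"
    using Cyz[OF z] z by (simp add: Cy inner_add_left inner_add_right inner_commute)
  ultimately have Cy': "C y = r *\<^sub>R x"
    using yy by (simp add: Cy)
  have "C y \<bullet> x = - (y \<bullet> y)"
    by (simp add: skew[of y] y_def[symmetric])
  then have r0: "r \<noteq> 0"
    using yy by (auto simp: Cy')
  obtain z where z: "z \<noteq> 0" "z \<bullet> x = 0" "z \<bullet> y = 0"
    using exists_orthogonal_to_two[OF dim3] .
  \<comment> \<open>The eigenvalue at \<open>y\<close> follows from \<open>z\<close> in the same way as the one at \<open>z\<close> from \<open>x\<close>, and
    \<open>t \<mapsto> - a / (b t)\<close> is an involution.\<close>
  have "B y = (- a / (b * m)) *\<^sub>R y"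
    using B_on_complement[OF Bz[OF z(2,3)] z(1), of y] Cz[OF z(2,3)] z by (simp add: inner_commute)
  moreover have "- a / (b * m) = l"
    using nz l0 by (simp add: m_def)
  ultimately have By: "B y = l *\<^sub>R y"
    by (simp only:)
  have "C z = 0 \<and> B z = m *\<^sub>R z" if "z \<bullet> x = 0" "z \<bullet> y = 0" for z
    using Cz[OF that] Bz[OF that] ..
  then show thesis
    by (rule that[OF x0 y0 yx(1) y_def[symmetric] Cy' r0 Bx By])
qed

lemma B_C_commute: "B \<circ> C = C \<circ> B"
proof
  fix v
  obtain x y l m k where p: "x \<noteq> 0" "y \<noteq> 0" "y \<bullet> x = 0" "C x = y" "C y = k *\<^sub>R x"
    "B x = l *\<^sub>R x" "B y = l *\<^sub>R y"
    and c: "\<And>z. z \<bullet> x = 0 \<Longrightarrow> z \<bullet> y = 0 \<Longrightarrow> C z = 0 \<and> B z = m *\<^sub>R z"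
    using plane_structure by metis
  obtain r s z where v: "v = r *\<^sub>R x + s *\<^sub>R y + z" and z: "z \<bullet> x = 0" "z \<bullet> y = 0"
    using orthogonal_decomposition_two[OF p(1-3)] .
  show "(B \<circ> C) v = (C \<circ> B) v"
    using p c[OF z] by (simp add: v B.add B.scale C.add C.scale B.zero C.zero algebra_simps)
qed

lemma dim_range_C: "dim (range C) = 2"
proof -
  obtain x y m k where p: "x \<noteq> 0" "y \<noteq> 0" "y \<bullet> x = 0" "C x = y" "C y = k *\<^sub>R x" "k \<noteq> 0"
    and c: "\<And>z. z \<bullet> x = 0 \<Longrightarrow> z \<bullet> y = 0 \<Longrightarrow> C z = 0 \<and> B z = m *\<^sub>R z"
    using plane_structure by metis
  have "range C = span {x, y}"
  proof
    show "range C \<subseteq> span {x, y}"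
    proof
      fix u assume "u \<in> range C"
      then obtain v where u: "u = C v" ..
      obtain r s z where v: "v = r *\<^sub>R x + s *\<^sub>R y + z" and z: "z \<bullet> x = 0" "z \<bullet> y = 0"
        using orthogonal_decomposition_two[OF p(1-3)] .
      have "u = r *\<^sub>R y + (s * k) *\<^sub>R x"
        using p c[OF z] by (simp add: u v C.add C.scale)
      then show "u \<in> span {x, y}"
        by (simp add: span_add span_scale span_base)
    qed
    have "x = C ((1 / k) *\<^sub>R y)" "y = C x"
      using p by (auto simp: C.scale)
    then have "{x, y} \<subseteq> range C"
      by blast
    then show "span {x, y} \<subseteq> range C"
      by (rule span_minimal) (rule linear_subspace_image[OF linC subspace_UNIV])
  qed
  moreover have "x \<noteq> y"
    using p by auto
  moreover have "independent {x, y}"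
    using p by (intro pairwise_orthogonal_independent)
      (auto simp: pairwise_def orthogonal_def inner_commute)
  ultimately show ?thesis
    by (simp add: dim_eq_card_independent)
qed

end

theorem lemma4p3:
  fixes B C :: "'v::euclidean_space \<Rightarrow> 'v"
  assumes "linear B" and "linear C"
    and "B = adjoint B"
    and "C = (\<lambda>x. - adjoint C x)"
    and "DIM('v) \<ge> 3"
    and "properly_lin_dependent_family ((!) [R_S id, R_S B, R_Lambda C]) {..<3}"
  shows "B \<circ> C = C \<circ> B \<and> dim (range C) = 2"
proof -
  let ?T = "(!) [R_S id, R_S B, R_Lambda C]"
  have idx: "{..<3::nat} = {0, 1, 2}"
    by auto
  obtain c where "finite {..<3::nat}" and c: "\<forall>i\<in>{..<3::nat}. c i \<noteq> 0"
    and rel: "\<forall>x y z w. (\<Sum>i<3. c i * ?T i x y z w) = 0"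
    using properly_lin_dependent_family_coeffs[OF assms(6)] .
  obtain x y z w where "?T 2 x y z w \<noteq> 0"
  proof (rule properly_lin_dependent_family_nonzero[OF assms(6)])
    show "{..<3::nat} \<noteq> {2}"
      unfolding idx by (simp add: insert_eq_iff)
  qed auto
  then have nonzero: "\<exists>v. C v \<noteq> 0"
    by (rule contrapos_np) (simp add: R_Lambda_def)
  interpret curvature_relation B C "c 0" "c 1" "c 2"
  proof
    show "B u \<bullet> v = u \<bullet> B v" for u v
      using adjoint_works[OF assms(1), of u v] assms(3) by simp
    show "C u \<bullet> v = - (u \<bullet> C v)" for u v
      using adjoint_works[OF assms(2), of u v] fun_cong[OF assms(4), of v] by simp
    show "c 0 * R_S id x y z w + c 1 * R_S B x y z w + c 2 * R_Lambda C x y z w = 0" for x y z w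
      using rel by (simp add: idx add.assoc)
  qed (use assms(1,2,5) c nonzero in \<open>simp_all add: linear_iff\<close>)
  show ?thesis
    using B_C_commute dim_range_C by blast
qed

end
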